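(* Let $\alpha\in(0,1)$, $n\in\mathbb N=\{1,2,\dots\}$, $0<a<b$, and $x\in C^{n+1}[a,b]$. Then for every $t\in\,]a,b[$, $$ \begin{aligned} {_t\mathcal{D}_b^\alpha} x(t)={}&\frac{1}{\Gamma(1-\alpha)}\left(\ln\frac{b}{t}\right)^{-\alpha}x(t)+\sum_{i=1}^{n}A_i(\alpha)\left(\ln\frac{b}{t}\right)^{i-\alpha} x_{i,0}(t)\\ &+\sum_{p=n+1}^\infty\left[B(\alpha,p)\left(\ln\frac{b}{t}\right)^{n-\alpha-p}W_p(t)+\frac{\Gamma(p+\alpha-n)}{\Gamma(1-\alpha)\Gamma(\alpha)(p-n)!}\left(\ln\frac{b}{t}\right)^{-\alpha}x(t)\right] \end{aligned} $$ (the series, including those defining $A_i(\alpha)$, being convergent), where $$ A_i(\alpha)=\frac{(-1)^i}{\Gamma(i+1-\alpha)}\left[1+\sum_{p=n-i+1}^\infty\frac{\Gamma(p+\alpha-n)}{\Gamma(\alpha-i)(p-n+i)!}\right],\quad i\in\{1,\ldots,n\}, $$ $$ B(\alpha,p)=\frac{\Gamma(p+\alpha-n)}{\Gamma(-\alpha)\Gamma(1+\alpha)(p-n)!},\qquad W_p(t)=\int_t^b (p-n)\left(\ln\frac{b}{\tau}\right)^{p-n-1}\frac{x(\tau)}{\tau}\,d\tau,\quad p\in\{n+1,n+2,\ldots\}. $$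
   Context: For $0<a<b$ and $\alpha\in(0,1)$, the right Hadamard fractional derivative of order $\alpha$ of $x:[a,b]\to\mathbb R$ is $$ {_t\mathcal{D}_b^\alpha} x(t)=-t\frac{d}{dt}\,\frac{1}{\Gamma(1-\alpha)}\int_t^b \left(\ln\frac{\tau}{t}\right)^{-\alpha}\frac{x(\tau)}{\tau}\,d\tau,\quad t\in\,]a,b[. $$ For absolutely continuous $x$ it equals $$ \frac{x(b)}{\Gamma(1-\alpha)}\left(\ln\frac{b}{t}\right)^{-\alpha}-\frac{1}{\Gamma(1-\alpha)}\int_t^b \left(\ln\frac{\tau}{t}\right)^{-\alpha}\dot{x}(\tau)\,d\tau . $$ The functions $x_{k,0}$ are defined recursively for $k\ge 0$ by $x_{0,0}(t)=x(t)$, $x_{k+1,0}(t)=t\frac{d}{dt}x_{k,0}(t)$. *)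

theory Defs
  imports "HOL-Analysis.Analysis"
begin

text \<open>
  The class of k times continuously differentiable functions on a set.  On a closed interval
  the derivatives at the end points are one-sided.
\<close>

fun C_k_on :: "nat \<Rightarrow> (real \<Rightarrow> real) \<Rightarrow> real set \<Rightarrow> bool" where
  "C_k_on 0 f S \<longleftrightarrow> continuous_on S f"
| "C_k_on (Suc k) f S \<longleftrightarrow>
     (\<exists>g. (\<forall>t\<in>S. (f has_real_derivative g t) (at t within S)) \<and> C_k_on k g S)"

definition right_hadamard_integral :: "real \<Rightarrow> real \<Rightarrow> (real \<Rightarrow> real) \<Rightarrow> real \<Rightarrow> real" where
  "right_hadamard_integral \<alpha> b x t =
     1 / Gamma (1 - \<alpha>) *
       (LINT \<tau>:{t..b}|lebesgue. ln (\<tau> / t) powr (- \<alpha>) * (x \<tau> / \<tau>))"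

text \<open>
  \<^const>\<open>deriv\<close> is unspecified where the derivative does not exist, so
  differentiability of \<^const>\<open>right_hadamard_integral\<close> has to be asserted separately.
\<close>

definition right_hadamard_deriv :: "real \<Rightarrow> real \<Rightarrow> (real \<Rightarrow> real) \<Rightarrow> real \<Rightarrow> real" where
  "right_hadamard_deriv \<alpha> b x t = - t * deriv (right_hadamard_integral \<alpha> b x) t"

text \<open>
  The functions \<open>x\<^sub>k\<^sub>,\<^sub>0\<close>.  The two-sided derivative is the intended one at interior points only.
\<close>

fun x_iter :: "(real \<Rightarrow> real) \<Rightarrow> nat \<Rightarrow> real \<Rightarrow> real" where
  "x_iter x 0 = x"
| "x_iter x (Suc k) = (\<lambda>t. t * deriv (x_iter x k) t)"

text \<open>
  The coefficient series starts at \<open>p = n - i + 1\<close>, so that truncated subtraction is exact in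
  \<open>p + i - n\<close>; likewise \<open>p - n\<close> and \<open>p - n - 1\<close> below are only used for \<open>p \<ge> n + 1\<close>.
\<close>

definition A_term :: "real \<Rightarrow> nat \<Rightarrow> nat \<Rightarrow> nat \<Rightarrow> real" where
  "A_term \<alpha> n i p =
     Gamma (real p + \<alpha> - real n) / (Gamma (\<alpha> - real i) * fact (p + i - n))"

definition A_coeff :: "real \<Rightarrow> nat \<Rightarrow> nat \<Rightarrow> real" where
  "A_coeff \<alpha> n i =
     (-1) ^ i / Gamma (real i + 1 - \<alpha>) * (1 + (\<Sum>k. A_term \<alpha> n i (n - i + 1 + k)))"

definition B_coeff :: "real \<Rightarrow> nat \<Rightarrow> nat \<Rightarrow> real" where
  "B_coeff \<alpha> n p =
     Gamma (real p + \<alpha> - real n) / (Gamma (- \<alpha>) * Gamma (1 + \<alpha>) * fact (p - n))"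

definition W :: "real \<Rightarrow> (real \<Rightarrow> real) \<Rightarrow> nat \<Rightarrow> nat \<Rightarrow> real \<Rightarrow> real" where
  "W b x n p t =
     (LINT \<tau>:{t..b}|lebesgue. real (p - n) * ln (b / \<tau>) ^ (p - n - 1) * (x \<tau> / \<tau>))"

definition expansion_term ::
    "real \<Rightarrow> real \<Rightarrow> (real \<Rightarrow> real) \<Rightarrow> nat \<Rightarrow> real \<Rightarrow> nat \<Rightarrow> real" where
  "expansion_term \<alpha> b x n t p =
     B_coeff \<alpha> n p * ln (b / t) powr (real n - \<alpha> - real p) * W b x n p t
     + Gamma (real p + \<alpha> - real n) / (Gamma (1 - \<alpha>) * Gamma \<alpha> * fact (p - n))
         * ln (b / t) powr (- \<alpha>) * x t"

end

(*
  Put z s = x (b * exp (- s)) and L = ln (b / t).  The substitution tau = b * exp (- s) turns the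
  right Hadamard derivative into the left Riemann-Liouville derivative of z at L, that is,
  1 / Gamma (1 - alpha) * (z 0 * L powr (- alpha) + integral of (L - s) powr (- alpha) * z' s over
  {0..L}).  Integrating W_p by parts, its boundary term cancels the x(t)-term of the same index,
  and with m = p - n what remains is, up to the factor L powr (- alpha) / Gamma (1 - alpha), the
  m-th term of the binomial series of (1 - s / L) powr (- alpha) integrated against z';
  dominated convergence sums the series.  All coefficients A_i vanish: 1 plus the series in A_i is the binomial series of
  (1 - q) powr (i - alpha) at q = 1.

  The kernel singularity is removed by s = L * (1 - w powr beta) with beta = 1 / (1 - alpha), for
  which (L - s) powr (- alpha) ds becomes a constant multiple of dw.  All integrals are then over
  w in [0, 1] with continuous integrands, and the integral may be differentiated in L under the
  integral sign.
*)

theory Submission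
  imports Defs "HOL-Real_Asymp.Real_Asymp"
begin

section \<open>Alternating binomial series and the vanishing of the coefficients A_i\<close>

text \<open>The partial sums telescope to \<open>(- 1) ^ m * ((c - 1) gchoose m)\<close>. By the
  Gamma asymptotics this has order m powr (- c), which tends to 0 because
  \<open>0 < c\<close>.\<close>

lemma gbinomial_alternating_sums_0:
  fixes c :: real
  assumes "0 < c"
  shows "(\<lambda>k. (c gchoose k) * (- 1) ^ k) sums 0"
proof -
  have lim: "(\<lambda>m. ((c - 1) gchoose m) / ((- 1) ^ m / exp (c * ln (real m)))) \<longlonglongrightarrow>
      inverse (Gamma (- (c - 1)))"
    using gbinomial_asymptotic[of "c - 1"] by simp
  have decay: "(\<lambda>m. exp (- c * ln (real m))) \<longlonglongrightarrow> 0"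
    using assms by real_asymp
  have "(\<lambda>m. (- 1) ^ m * ((c - 1) gchoose m)) \<longlonglongrightarrow> 0"
  proof (rule Lim_transform_eventually)
    show "(\<lambda>m. ((c - 1) gchoose m) / ((- 1) ^ m / exp (c * ln (real m)))
        * exp (- c * ln (real m))) \<longlonglongrightarrow> 0"
      using tendsto_mult[OF lim decay] by simp
    have "((c - 1) gchoose m) / ((- 1) ^ m / exp (c * ln (real m))) * exp (- c * ln (real m))
        = (- 1) ^ m * ((c - 1) gchoose m)" for m
      by (cases "even m") (simp_all add: exp_minus)
    then show "\<forall>\<^sub>F m in sequentially.
        ((c - 1) gchoose m) / ((- 1) ^ m / exp (c * ln (real m))) * exp (- c * ln (real m))
        = (- 1) ^ m * ((c - 1) gchoose m)"
      by simp
  qed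
  then show ?thesis
    by (simp add: sums_def_le gbinomial_sum_lower_neg)
qed

text \<open>With \<open>c = real i - \<alpha>\<close>, the Gamma quotient is a Pochhammer symbol of
  \<open>- c\<close>, and the terms are those of the alternating binomial series of \<open>c\<close>
  from index 1 on. Its total is 0 and its missing term of index 0 is 1.\<close>

lemma A_term_sums:
  assumes "0 < \<alpha>" "\<alpha> < 1" "1 \<le> i" "i \<le> n"
  shows "(\<lambda>k. A_term \<alpha> n i (n - i + 1 + k)) sums (- 1)"
proof -
  define c where "c = real i - \<alpha>"
  have "0 < c" using assms by (simp add: c_def)
  \<comment> \<open>This keeps \<open>Gamma\<close> away from its poles at \<open>- c\<close>, as
    the Gamma formula for \<open>pochhammer\<close> requires.\<close>
  have "- c \<notin> \<int>"
  proof
    assume "- c \<in> \<int>"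
    then have "\<alpha> \<in> \<int>"
      using Ints_add[of "- c" "real i"] by (simp add: c_def)
    then show False using assms by (auto elim!: Ints_cases)
  qed
  then have "- c \<notin> \<int>\<^sub>\<le>\<^sub>0"
    using nonpos_Ints_subset_Ints by blast
  have "A_term \<alpha> n i (n - i + 1 + k) = (c gchoose Suc k) * (- 1) ^ Suc k" for k
  proof -
    have "real (n - i + 1 + k) + \<alpha> - real n = - c + real (Suc k)"
      using assms by (simp add: c_def)
    moreover have "n - i + 1 + k + i - n = Suc k"
      using assms by simp
    ultimately have "A_term \<alpha> n i (n - i + 1 + k) = pochhammer (- c) (Suc k) / fact (Suc k)"
      using pochhammer_Gamma[OF \<open>- c \<notin> \<int>\<^sub>\<le>\<^sub>0\<close>, of "Suc k"]
      by (simp add: A_term_def c_def algebra_simps)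
    also have "\<dots> = (c gchoose Suc k) * (- 1) ^ Suc k"
      unfolding gbinomial_pochhammer by (cases "even k") simp_all
    finally show ?thesis .
  qed
  moreover have "(\<lambda>k. (c gchoose Suc k) * (- 1) ^ Suc k) sums (0 - (c gchoose 0) * (- 1) ^ 0)"
    using gbinomial_alternating_sums_0[OF \<open>0 < c\<close>] by (subst sums_Suc_iff) simp
  ultimately show ?thesis by simp
qed

section \<open>Change of variables from the interval {t..b} to the unit interval\<close>

lemma C_k_on_imp_continuous_on:
  "C_k_on k f S \<Longrightarrow> continuous_on S f"
proof (cases k)
  case (Suc j)
  assume "C_k_on k f S"
  then show ?thesis
    using Suc by (auto intro: DERIV_continuous_on)
qed simp

text \<open>Substitution tau = b * exp (- L * (1 - w powr beta)), taking w = 0 to \<open>t\<close>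
  and w = 1 to \<open>b\<close>. The integrand \<open>f\<close> may be singular at \<open>t\<close>;
  the continuous \<open>h\<close> is \<open>f\<close> times the Jacobian inside the unit interval,
  and its integrability carries over to \<open>f\<close>.\<close>

lemma set_lebesgue_integral_log_power_subst:
  fixes f h :: "real \<Rightarrow> real"
  assumes "0 < t" "t < b" "1 < \<beta>"
    and cont: "continuous_on {0..1} h"
    and h: "\<And>w. \<lbrakk>0 < w; w < 1\<rbrakk> \<Longrightarrow> h w =
      ln (b / t) * \<beta> * w powr (\<beta> - 1) * (b * exp (- (ln (b / t) * (1 - w powr \<beta>)))) *
      f (b * exp (- (ln (b / t) * (1 - w powr \<beta>))))"
  shows "(LINT \<tau>:{t..b}|lebesgue. f \<tau>) = integral {0..1} h"
proof -
  define L where "L = ln (b / t)"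
  define g where "g = (\<lambda>w. b * exp (- (L * (1 - w powr \<beta>))))"
  define g' where "g' = (\<lambda>w. L * \<beta> * w powr (\<beta> - 1) * g w)"
  have "0 < L" "0 < b" using assms by (auto simp: L_def)
  have t: "t = b * exp (- L)"
    using assms by (simp add: L_def exp_minus)
  have der: "(g has_field_derivative g' w) (at w within {0<..<1})" if "w \<in> {0<..<1}" for w
    unfolding g_def g'_def using that
    by (auto intro!: derivative_eq_intros simp: powr_diff)
  have inj: "inj_on g {0<..<1}"
  proof (rule inj_on_inverseI)
    fix w :: real assume "w \<in> {0<..<1}"
    moreover have "ln (g w / b) = - (L * (1 - w powr \<beta>))"
      using \<open>0 < b\<close> by (simp add: g_def)
    ultimately show "(1 + ln (g w / b) / L) powr (1 / \<beta>) = w"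
      using \<open>0 < L\<close> assms(3) by (simp add: powr_powr)
  qed
  have img: "g ` {0<..<1} = {t<..<b}"
  proof (intro equalityI subsetI)
    fix y assume "y \<in> g ` {0<..<1}"
    then obtain w where w: "0 < w" "w < 1" "y = g w" by auto
    have "0 < w powr \<beta>" "w powr \<beta> < 1"
      using w assms(3) powr_less_mono2[of \<beta> w 1] by auto
    then show "y \<in> {t<..<b}"
      using \<open>0 < L\<close> \<open>0 < b\<close> w unfolding t by (auto simp: g_def)
  next
    fix y assume y: "y \<in> {t<..<b}"
    \<comment> \<open>\<open>v\<close> is the value of \<open>w powr \<beta>\<close> at the preimage
      of \<open>y\<close>, obtained from L * (1 - v) = ln (b / y).\<close>
    define v where "v = 1 - ln (b / y) / L"
    have "0 < ln (b / y)" "ln (b / y) < L"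
      using y assms(1) by (auto simp: L_def divide_strict_left_mono)
    then have v: "0 < v" "v < 1" using \<open>0 < L\<close> by (auto simp: v_def field_simps)
    then have "v powr (1 / \<beta>) < 1"
      using powr_less_mono2[of "1 / \<beta>" v 1] assms(3) by auto
    moreover have "g (v powr (1 / \<beta>)) = y"
    proof -
      have "L * (1 - v) = ln (b / y)" using \<open>0 < L\<close> by (simp add: v_def)
      moreover have "(v powr (1 / \<beta>)) powr \<beta> = v" using v assms(3) by (simp add: powr_powr)
      ultimately show ?thesis
        using y assms(1) \<open>0 < b\<close> by (simp add: g_def exp_minus)
    qed
    ultimately show "y \<in> g ` {0<..<1}"
      using v by (intro image_eqI[of _ _ "v powr (1 / \<beta>)"]) auto
  qed
  have h': "\<bar>g' w\<bar> * f (g w) = h w" if "w \<in> {0<..<1}" for w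
    using that h[of w] \<open>0 < L\<close> \<open>0 < b\<close> assms(3) by (simp add: g'_def g_def L_def abs_mult)
  have "h absolutely_integrable_on {0..1}"
    using cont by (rule absolutely_integrable_continuous_real)
  then have "h absolutely_integrable_on {0<..<1}"
    by (rule set_integrable_subset) auto
  then have "(\<lambda>w. \<bar>g' w\<bar> * f (g w)) absolutely_integrable_on {0<..<1}"
    using h' by (metis (mono_tags, lifting) set_integrable_cong)
  moreover have "integral {0<..<1} (\<lambda>w. \<bar>g' w\<bar> * f (g w)) = integral {0..1} h"
    using integral_cong[OF h'] by (simp only: integral_open_interval_real)
  ultimately have f: "f absolutely_integrable_on {t<..<b}" "integral {t<..<b} f = integral {0..1} h"
    using has_absolute_integral_change_of_variables_1'[OF _ der inj, of f "integral {0..1} h"]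
    unfolding img by auto
  \<comment> \<open>The two end points form a null set, so the value of \<open>f\<close> at a
    singularity there is irrelevant.\<close>
  have "f absolutely_integrable_on {t..b}"
  proof (rule absolutely_integrable_spike_set[OF f(1)])
    show "negligible {\<tau> \<in> {t<..<b} - {t..b}. f \<tau> \<noteq> 0}"
      by (auto intro: empty_imp_negligible)
    show "negligible {\<tau> \<in> {t..b} - {t<..<b}. f \<tau> \<noteq> 0}"
      by (rule negligible_subset[of "{t, b}"]) auto
  qed
  then show ?thesis
    using f(2) by (simp add: set_lebesgue_integral_eq_integral integral_open_interval_real)
qed


section \<open>The binomial kernel and integrals along s = L * (1 - w powr beta)\<close>

text \<open>The binomial theorem at \<open>- q\<close>: the signs of \<open>(- q) ^ m\<close> and of
  the binomial coefficients of \<open>- \<alpha>\<close> cancel.\<close>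

lemma binomial_kernel_sums:
  fixes \<alpha> q :: real
  assumes "0 \<le> q" "q < 1"
  shows "(\<lambda>m. pochhammer \<alpha> m / fact m * q ^ m) sums (1 - q) powr (- \<alpha>)"
proof -
  have "((- \<alpha>) gchoose m) * (- q) ^ m = pochhammer \<alpha> m / fact m * q ^ m" for m
    unfolding gbinomial_pochhammer by (cases "even m") simp_all
  then show ?thesis
    using gen_binomial_real[of "- q" "- \<alpha>"] assms by simp
qed

lemma continuous_on_powr_unit:
  assumes "0 < c"
  shows "continuous_on {0..1} (\<lambda>w::real. w powr c)"
  using assms by (intro continuous_on_powr') (auto intro!: continuous_intros)

context
  fixes z z' :: "real \<Rightarrow> real" and M \<beta> :: real
  assumes \<beta>: "1 < \<beta>"
    and z_deriv: "\<forall>s\<in>{0..M}. (z has_real_derivative z' s) (at s within {0..M})"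
    and z'_cont: "continuous_on {0..M} z'"
begin

lemma param_in_range:
  assumes "0 < L" "L < M" "w \<in> {0..1}"
  shows "L * (1 - w powr \<beta>) \<in> {0..M}"
proof -
  have "0 \<le> w powr \<beta>" "w powr \<beta> \<le> 1"
    using assms \<beta> by (auto simp: powr_le1)
  then have "0 \<le> L * (1 - w powr \<beta>)" "L * (1 - w powr \<beta>) \<le> L * 1"
    using assms by (auto intro: mult_left_mono)
  then show ?thesis using assms(2) unfolding atLeastAtMost_iff by linarith
qed

lemma continuous_on_param:
  assumes "0 < L" "L < M" "continuous_on {0..M} h"
  shows "continuous_on {0..1} (\<lambda>w. h (L * (1 - w powr \<beta>)))"
  using \<beta> param_in_range[OF assms(1,2)]
  by (intro continuous_on_compose2[OF assms(3)] continuous_on_powr_unit continuous_intros) auto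

lemma z_cont: "continuous_on {0..M} z"
  using z_deriv by (auto intro: DERIV_continuous_on)

text \<open>For w strictly between 0 and 1 the inner point lies strictly inside {0..M}, where the
  derivative of \<open>z\<close> within the interval is two-sided.\<close>

lemma has_derivative_param:
  assumes "0 < L" "L < M" "0 < w" "w < 1"
  shows "((\<lambda>w. z (L * (1 - w powr \<beta>))) has_real_derivative
     - (L * \<beta> * w powr (\<beta> - 1) * z' (L * (1 - w powr \<beta>)))) (at w)"
proof -
  have "w powr \<beta> < 1" "0 < w powr \<beta>"
    using assms \<beta> powr_less_mono2[of \<beta> w 1] by auto
  then have "0 < L * (1 - w powr \<beta>)" "L * (1 - w powr \<beta>) < L * 1"
    using assms by (auto intro: mult_strict_left_mono)
  then have s: "0 < L * (1 - w powr \<beta>)" "L * (1 - w powr \<beta>) < M"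
    using assms(2) by linarith+
  then have z: "(z has_real_derivative z' (L * (1 - w powr \<beta>))) (at (L * (1 - w powr \<beta>)))"
    using bspec[OF z_deriv, of "L * (1 - w powr \<beta>)"] by (simp add: at_within_Icc_at)
  have "((\<lambda>w. L * (1 - w powr \<beta>)) has_real_derivative - (L * \<beta> * w powr (\<beta> - 1))) (at w)"
    using assms by (auto intro!: derivative_eq_intros simp: powr_diff)
  from DERIV_chain2[OF z this] show ?thesis by (simp add: mult_ac)
qed

text \<open>In the variable s this is the integral of \<open>z'\<close> over {0..L}; w = 0
  corresponds to s = L and w = 1 to s = 0. It evaluates the moment of order 0 in the binomial
  series.\<close>

lemma integral_param_deriv:
  assumes "0 < L" "L < M"
  shows "L * \<beta> * integral {0..1} (\<lambda>w. w powr (\<beta> - 1) * z' (L * (1 - w powr \<beta>))) = z L - z 0"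
proof -
  have "((\<lambda>w. - (L * \<beta> * w powr (\<beta> - 1) * z' (L * (1 - w powr \<beta>))))
      has_integral (z (L * (1 - 1 powr \<beta>)) - z (L * (1 - 0 powr \<beta>)))) {0..1}"
    using has_derivative_param[OF assms] continuous_on_param[OF assms z_cont]
    by (intro fundamental_theorem_of_calculus_interior)
       (auto simp: has_real_derivative_iff_has_vector_derivative)
  from has_integral_neg[OF this] show ?thesis
    using \<beta> by (auto dest!: integral_unique simp: mult.assoc)
qed

text \<open>Integrating the derivative of w * z (L * (1 - w powr beta)) trades \<open>z\<close> for
  \<open>z'\<close>; the boundary term at w = 1 is \<open>z 0\<close>.\<close>

lemma integral_param_by_parts:
  assumes "0 < L" "L < M"
  shows "integral {0..1} (\<lambda>w. z (L * (1 - w powr \<beta>))) =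
    z 0 + L * \<beta> * integral {0..1} (\<lambda>w. w powr \<beta> * z' (L * (1 - w powr \<beta>)))"
proof -
  let ?F = "\<lambda>w. w * z (L * (1 - w powr \<beta>))"
  have "((\<lambda>w. z (L * (1 - w powr \<beta>)) - L * \<beta> * (w powr \<beta> * z' (L * (1 - w powr \<beta>))))
      has_integral (?F 1 - ?F 0)) {0..1}"
  proof (rule fundamental_theorem_of_calculus_interior)
    fix w :: real assume w: "w \<in> {0<..<1}"
    have "(?F has_real_derivative
        z (L * (1 - w powr \<beta>)) - L * \<beta> * (w powr \<beta> * z' (L * (1 - w powr \<beta>)))) (at w)"
    proof (rule DERIV_cong)
      show "(?F has_real_derivative 1 * z (L * (1 - w powr \<beta>)) +
          - (L * \<beta> * w powr (\<beta> - 1) * z' (L * (1 - w powr \<beta>))) * w) (at w)"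
        using w by (intro DERIV_mult DERIV_ident has_derivative_param[OF assms]) auto
    qed (use w in \<open>simp add: powr_diff\<close>)
    then show "(?F has_vector_derivative
        z (L * (1 - w powr \<beta>)) - L * \<beta> * (w powr \<beta> * z' (L * (1 - w powr \<beta>)))) (at w)"
      by (simp add: has_real_derivative_iff_has_vector_derivative)
  qed (use continuous_on_param[OF assms z_cont] in \<open>auto intro!: continuous_intros\<close>)
  moreover have "((\<lambda>w. L * \<beta> * (w powr \<beta> * z' (L * (1 - w powr \<beta>)))) has_integral
      L * \<beta> * integral {0..1} (\<lambda>w. w powr \<beta> * z' (L * (1 - w powr \<beta>)))) {0..1}"
    using \<beta>
    by (intro has_integral_mult_right integrable_integral integrable_continuous_real
        continuous_on_param[OF assms z'_cont] continuous_on_powr_unit continuous_intros) auto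
  ultimately have "((\<lambda>w. z (L * (1 - w powr \<beta>))) has_integral (?F 1 - ?F 0) +
      L * \<beta> * integral {0..1} (\<lambda>w. w powr \<beta> * z' (L * (1 - w powr \<beta>)))) {0..1}"
    by (auto dest: has_integral_add simp only: diff_add_cancel)
  then show ?thesis
    by (simp add: integral_unique)
qed

text \<open>Integration by parts for W_p with p = n + 1 + k, using the antiderivative s ^ (k + 1) *
  z s. Its boundary term vanishes at s = 0 and gives \<open>L ^ Suc k * z L\<close> at s =
  L.\<close>

lemma integral_param_moment:
  assumes "0 < L" "L < M"
  shows "integral {0..1} (\<lambda>w. L * \<beta> * w powr (\<beta> - 1) *
      (real (Suc k) * (L * (1 - w powr \<beta>)) ^ k * z (L * (1 - w powr \<beta>)))) =
    L ^ Suc k * (z L - L * \<beta> * integral {0..1}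
      (\<lambda>w. (1 - w powr \<beta>) ^ Suc k * w powr (\<beta> - 1) * z' (L * (1 - w powr \<beta>))))"
    (is "integral _ ?f = L ^ Suc k * (z L - L * \<beta> * integral _ ?g)")
proof -
  let ?F = "\<lambda>w. - ((L * (1 - w powr \<beta>)) ^ Suc k * z (L * (1 - w powr \<beta>)))"
  have "((\<lambda>w. ?f w + L ^ Suc k * L * \<beta> * ?g w) has_integral (?F 1 - ?F 0)) {0..1}"
  proof (rule fundamental_theorem_of_calculus_interior)
    fix w :: real assume w: "w \<in> {0<..<1}"
    have "((\<lambda>w. L * (1 - w powr \<beta>)) has_real_derivative - (L * \<beta> * w powr (\<beta> - 1))) (at w)"
      using w by (auto intro!: derivative_eq_intros simp: powr_diff)
    from DERIV_power[OF this, of "Suc k"]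
    have "((\<lambda>w. (L * (1 - w powr \<beta>)) ^ Suc k) has_real_derivative
        - (real (Suc k) * (L * (1 - w powr \<beta>)) ^ k * (L * \<beta> * w powr (\<beta> - 1)))) (at w)"
      by (simp add: mult_ac del: power_Suc)
    from DERIV_minus[OF DERIV_mult[OF this has_derivative_param[OF assms, of w]]] w
    have "(?F has_real_derivative
        - (- (real (Suc k) * (L * (1 - w powr \<beta>)) ^ k * (L * \<beta> * w powr (\<beta> - 1))) *
            z (L * (1 - w powr \<beta>)) +
          - (L * \<beta> * w powr (\<beta> - 1) * z' (L * (1 - w powr \<beta>))) *
            (L * (1 - w powr \<beta>)) ^ Suc k)) (at w)"
      by simp
    \<comment> \<open>The powers of w and the values of \<open>z\<close> and \<open>z'\<close> are
      abstracted to variables, so that the identity is purely polynomial.\<close>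
    moreover have "- (- (real (Suc k) * (L * u) ^ k * (L * \<beta> * v)) * y +
          - (L * \<beta> * v * y') * (L * u) ^ Suc k) =
        L * \<beta> * v * (real (Suc k) * (L * u) ^ k * y) + L ^ Suc k * L * \<beta> * (u ^ Suc k * v * y')"
      for u v y y' :: real
      by (simp add: power_mult_distrib algebra_simps)
    ultimately have "(?F has_real_derivative ?f w + L ^ Suc k * L * \<beta> * ?g w) (at w)"
      by (simp only:)
    then show "(?F has_vector_derivative ?f w + L ^ Suc k * L * \<beta> * ?g w) (at w)"
      by (simp add: has_real_derivative_iff_has_vector_derivative)
  next
    show "continuous_on {0..1} ?F"
      using \<beta>
      by (intro continuous_on_param[OF assms z_cont] continuous_on_powr_unit continuous_intros) auto
  qed simp
  moreover have "((\<lambda>w. L ^ Suc k * L * \<beta> * ?g w) has_integral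
      L ^ Suc k * L * \<beta> * integral {0..1} ?g) {0..1}"
    using \<beta>
    by (intro has_integral_mult_right integrable_integral integrable_continuous_real
        continuous_on_param[OF assms z'_cont] continuous_on_powr_unit continuous_intros) auto
  ultimately have "(?f has_integral
      (?F 1 - ?F 0) - L ^ Suc k * L * \<beta> * integral {0..1} ?g) {0..1}"
    by (auto dest: has_integral_diff simp only: add_diff_cancel_right')
  from integral_unique[OF this] show ?thesis
    using \<beta> by (simp only:) (simp add: right_diff_distrib)
qed

text \<open>Leibniz rule: the domain of integration does not depend on \<open>L\<close>, and the
  partial derivative in \<open>L\<close> is jointly continuous.\<close>

lemma has_derivative_integral_param:
  assumes "0 < L" "L < M"
  shows "((\<lambda>L. integral {0..1} (\<lambda>w. z (L * (1 - w powr \<beta>)))) has_real_derivative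
    integral {0..1} (\<lambda>w. (1 - w powr \<beta>) * z' (L * (1 - w powr \<beta>)))) (at L)"
proof -
  have "((\<lambda>L. integral (cbox 0 1) (\<lambda>w. z (L * (1 - w powr \<beta>)))) has_real_derivative
    integral (cbox 0 1) (\<lambda>w. (1 - w powr \<beta>) * z' (L * (1 - w powr \<beta>)))) (at L within {0<..<M})"
  proof (rule leibniz_rule_field_derivative)
    fix l w :: real assume l: "l \<in> {0<..<M}" and w: "w \<in> cbox 0 1"
    \<comment> \<open>At w = 1 the inner function is constantly 0, an end point of {0..M}, so the
      chain rule is applied within the image.\<close>
    have "(\<lambda>l. l * (1 - w powr \<beta>)) ` {0<..<M} \<subseteq> {0..M}"
      using w param_in_range by auto
    then have "(z has_real_derivative z' (l * (1 - w powr \<beta>)))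
        (at (l * (1 - w powr \<beta>)) within (\<lambda>l. l * (1 - w powr \<beta>)) ` {0<..<M})"
      using l w param_in_range[of l w] by (intro has_field_derivative_subset[OF bspec[OF z_deriv]]) auto
    moreover have "((\<lambda>l. l * (1 - w powr \<beta>)) has_real_derivative 1 - w powr \<beta>)
        (at l within {0<..<M})"
      by (auto intro!: derivative_eq_intros)
    ultimately show "((\<lambda>l. z (l * (1 - w powr \<beta>))) has_real_derivative
        (1 - w powr \<beta>) * z' (l * (1 - w powr \<beta>))) (at l within {0<..<M})"
      using DERIV_image_chain[of z "z' (l * (1 - w powr \<beta>))" "\<lambda>l. l * (1 - w powr \<beta>)"]
      by (simp add: o_def mult.commute)
  next
    fix l assume "l \<in> {0<..<M}"
    then show "(\<lambda>w. z (l * (1 - w powr \<beta>))) integrable_on cbox 0 1"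
      using integrable_continuous_real[OF continuous_on_param[OF _ _ z_cont]] by simp
  next
    have powr: "continuous_on ({0<..<M} \<times> cbox 0 1) (\<lambda>p::real \<times> real. snd p powr \<beta>)"
      using \<beta> by (intro continuous_on_powr') (auto intro!: continuous_intros)
    have "continuous_on ({0<..<M} \<times> cbox 0 1) (\<lambda>p. z' (fst p * (1 - snd p powr \<beta>)))"
      using param_in_range
      by (intro continuous_on_compose2[OF z'_cont] continuous_intros powr) auto
    then show "continuous_on ({0<..<M} \<times> cbox 0 1)
        (\<lambda>(l, w). (1 - w powr \<beta>) * z' (l * (1 - w powr \<beta>)))"
      unfolding split_beta by (intro continuous_intros powr)
  qed (use assms in auto)
  then show ?thesis
    using assms by (simp add: at_within_open[of _ "{0<..<M}"])
qed

text \<open>Up to 1 / Gamma (1 - alpha), the differentiated function is the fractional integral of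
  \<open>z\<close> of order 1 - alpha. In the product rule the factor beta * (1 - alpha) is 1, and
  after integration by parts the terms with \<open>w powr \<beta>\<close> cancel.\<close>

lemma has_derivative_fractional_integral_param:
  assumes "0 < L" "L < M" and \<alpha>: "\<alpha> < 1" "\<beta> = 1 / (1 - \<alpha>)"
  shows "((\<lambda>L. \<beta> * L powr (1 - \<alpha>) * integral {0..1} (\<lambda>w. z (L * (1 - w powr \<beta>))))
    has_real_derivative
      L powr (- \<alpha>) * (z 0 + L * \<beta> * integral {0..1} (\<lambda>w. z' (L * (1 - w powr \<beta>))))) (at L)"
proof -
  have "(\<lambda>w. z' (L * (1 - w powr \<beta>))) integrable_on {0..1}"
    using integrable_continuous_real[OF continuous_on_param[OF assms(1,2) z'_cont]] .
  moreover have "(\<lambda>w. w powr \<beta> * z' (L * (1 - w powr \<beta>))) integrable_on {0..1}"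
    using \<beta>
    by (intro integrable_continuous_real continuous_on_param[OF assms(1,2) z'_cont]
        continuous_on_powr_unit continuous_intros) auto
  ultimately have split: "integral {0..1} (\<lambda>w. (1 - w powr \<beta>) * z' (L * (1 - w powr \<beta>))) =
      integral {0..1} (\<lambda>w. z' (L * (1 - w powr \<beta>))) -
      integral {0..1} (\<lambda>w. w powr \<beta> * z' (L * (1 - w powr \<beta>)))"
    by (simp add: left_diff_distrib integral_diff)
  have "\<beta> * (1 - \<alpha>) = 1" using \<alpha> by simp
  have "L powr (1 - \<alpha>) = L * L powr (- \<alpha>)"
    using assms by (simp add: powr_diff powr_minus divide_simps)
  have "((\<lambda>L. \<beta> * L powr (1 - \<alpha>)) has_real_derivative \<beta> * (1 - \<alpha>) * L powr (- \<alpha>)) (at L)"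
    using DERIV_cmult[OF has_real_derivative_powr[OF \<open>0 < L\<close>, of "1 - \<alpha>"], of \<beta>]
    by (simp add: mult.assoc)
  from DERIV_mult[OF this has_derivative_integral_param[OF assms(1,2)]]
  show ?thesis
    unfolding split integral_param_by_parts[OF assms(1,2)] \<open>\<beta> * (1 - \<alpha>) = 1\<close>
      \<open>L powr (1 - \<alpha>) = L * L powr (- \<alpha>)\<close>
    by (simp add: algebra_simps)
qed

text \<open>Here s / L = 1 - w powr beta, so the kernel series sums to w powr (- alpha * beta),
  which the weight w powr (beta - 1) compensates exactly. The weighted partial sums
  \<open>S N\<close> lie between 0 and 1, so the absolute value of \<open>\<phi>\<close>
  dominates.\<close>

lemma binomial_moment_series:
  assumes "0 < L" "L < M" and \<alpha>: "0 < \<alpha>" "\<alpha> < 1" "\<beta> = 1 / (1 - \<alpha>)"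
  shows "(\<lambda>m. pochhammer \<alpha> m / fact m * integral {0..1}
      (\<lambda>w. (1 - w powr \<beta>) ^ m * w powr (\<beta> - 1) * z' (L * (1 - w powr \<beta>)))) sums
    integral {0..1} (\<lambda>w. z' (L * (1 - w powr \<beta>)))"
proof -
  define c where "c = (\<lambda>m. pochhammer \<alpha> m / fact m)"
  define S where "S = (\<lambda>N w. (\<Sum>m<N. c m * (1 - w powr \<beta>) ^ m) * w powr (\<beta> - 1))"
  define \<phi> where "\<phi> = (\<lambda>w. z' (L * (1 - w powr \<beta>)))"
  have \<phi>: "continuous_on {0..1} \<phi>"
    unfolding \<phi>_def by (rule continuous_on_param[OF assms(1,2) z'_cont])
  have cont: "continuous_on {0..1} (\<lambda>w. (1 - w powr \<beta>) ^ m * w powr (\<beta> - 1) * \<phi> w)" for m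
    using \<beta> \<phi> by (intro continuous_on_powr_unit continuous_intros) auto
  have S_cont: "continuous_on {0..1} (S N)" for N
    unfolding S_def using \<beta> by (intro continuous_on_powr_unit continuous_intros) auto
  have "0 \<le> c m" for m
    using \<alpha> by (simp add: c_def pochhammer_nonneg)
  have S_lim: "(\<lambda>N. S N w) \<longlonglongrightarrow> 1" and S_le: "0 \<le> S N w \<and> S N w \<le> 1"
    if w: "0 < w" "w \<le> 1" for N w
  proof -
    have q: "0 \<le> 1 - w powr \<beta>" "1 - w powr \<beta> < 1"
      using w \<beta> by (auto simp: powr_le1)
    have sums: "(\<lambda>m. c m * (1 - w powr \<beta>) ^ m) sums (w powr \<beta>) powr (- \<alpha>)"
      using binomial_kernel_sums[OF q, of \<alpha>] by (simp add: c_def)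
    have "\<beta> * (- \<alpha>) + (\<beta> - 1) = 0" using \<alpha> by (simp add: field_simps)
    then have one: "(w powr \<beta>) powr (- \<alpha>) * w powr (\<beta> - 1) = 1"
      using w by (simp add: powr_powr powr_add[symmetric])
    show "(\<lambda>N. S N w) \<longlonglongrightarrow> 1"
      using tendsto_mult_right[OF sums[unfolded sums_def], of "w powr (\<beta> - 1)"] one
      by (simp add: S_def)
    have "(\<Sum>m<N. c m * (1 - w powr \<beta>) ^ m) \<le> (w powr \<beta>) powr (- \<alpha>)"
      using sum_le_suminf[OF sums_summable[OF sums], of "{..<N}"] sums_unique[OF sums]
        \<open>\<And>m. 0 \<le> c m\<close> q by simp
    then show "0 \<le> S N w \<and> S N w \<le> 1"
      using mult_right_mono[of _ _ "w powr (\<beta> - 1)"] one \<open>\<And>m. 0 \<le> c m\<close> q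
      by (fastforce simp: S_def intro!: mult_nonneg_nonneg sum_nonneg)
  qed
  \<comment> \<open>At w = 0 every \<open>S N w\<close> is 0, since
    \<open>0 powr (\<beta> - 1) = 0\<close>; the limit is adjusted at that single point.\<close>
  have "(\<lambda>N. integral {0..1} (\<lambda>w. S N w * \<phi> w)) \<longlonglongrightarrow> integral {0..1} (\<lambda>w. if w = 0 then 0 else \<phi> w)"
  proof (rule dominated_convergence(2))
    show "(\<lambda>w. S N w * \<phi> w) integrable_on {0..1}" for N
      using S_cont \<phi> by (intro integrable_continuous_real continuous_intros)
    show "(\<lambda>w. \<bar>\<phi> w\<bar>) integrable_on {0..1}"
      using \<phi> by (intro integrable_continuous_real continuous_intros)
    show "norm (S N w * \<phi> w) \<le> \<bar>\<phi> w\<bar>" if "w \<in> {0..1}" for N w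
    proof (cases "w = 0")
      case False
      then show ?thesis
        using S_le[of w N] that mult_right_mono[of "S N w" 1 "\<bar>\<phi> w\<bar>"] by (simp add: abs_mult)
    qed (simp add: S_def)
    show "(\<lambda>N. S N w * \<phi> w) \<longlonglongrightarrow> (if w = 0 then 0 else \<phi> w)" if "w \<in> {0..1}" for w
    proof (cases "w = 0")
      case False
      then show ?thesis
        using tendsto_mult_right[OF S_lim[of w], of "\<phi> w"] that by simp
    qed (simp add: S_def)
  qed
  also have "integral {0..1} (\<lambda>w. if w = 0 then 0 else \<phi> w) = integral {0..1} \<phi>"
    by (rule integral_spike[of "{0}"]) auto
  also have "(\<lambda>N. integral {0..1} (\<lambda>w. S N w * \<phi> w)) = (\<lambda>N. \<Sum>m<N. c m * integral {0..1}
      (\<lambda>w. (1 - w powr \<beta>) ^ m * w powr (\<beta> - 1) * \<phi> w))"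
  proof
    fix N
    have "integral {0..1} (\<lambda>w. S N w * \<phi> w) = integral {0..1}
        (\<lambda>w. \<Sum>m<N. c m * ((1 - w powr \<beta>) ^ m * w powr (\<beta> - 1) * \<phi> w))"
      by (simp add: S_def sum_distrib_right mult.assoc)
    also have "\<dots> = (\<Sum>m<N. c m * integral {0..1}
      (\<lambda>w. (1 - w powr \<beta>) ^ m * w powr (\<beta> - 1) * \<phi> w))"
      using integrable_continuous_real[OF continuous_on_mult_left[OF cont]]
      by (subst integral_sum) auto
    finally show "integral {0..1} (\<lambda>w. S N w * \<phi> w) = \<dots>" .
  qed
  finally show ?thesis
    unfolding sums_def c_def \<phi>_def .
qed

end


section \<open>The Hadamard integral, W_p and the expansion terms in the variable w\<close>

lemma exp_param_in_interval:
  fixes a b s :: real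
  assumes "0 < a" "a < b" "s \<in> {0..ln (b / a)}"
  shows "b * exp (- s) \<in> {a..b}"
proof -
  have "exp (- ln (b / a)) \<le> exp (- s)" "exp (- s) \<le> 1"
    using assms(3) unfolding exp_le_cancel_iff exp_le_one_iff by simp_all
  moreover have "exp (- ln (b / a)) = a / b"
    using assms by (simp add: exp_minus)
  ultimately show ?thesis
    using assms by (auto simp: field_simps)
qed

text \<open>Since tau / t = exp (L * w powr beta), the kernel becomes L powr (- alpha) * w powr (-
  alpha * beta). The Jacobian factor w powr (beta - 1) cancels its singularity, and the Jacobian
  factor tau cancels 1 / tau.\<close>

lemma right_hadamard_integral_param:
  assumes "0 < \<alpha>" "\<alpha> < 1" "\<beta> = 1 / (1 - \<alpha>)" "0 < t" "t < b"
    and cont: "continuous_on {0..1} (\<lambda>w. x (b * exp (- (ln (b / t) * (1 - w powr \<beta>)))))"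
  shows "right_hadamard_integral \<alpha> b x t = 1 / Gamma (1 - \<alpha>) *
    (\<beta> * ln (b / t) powr (1 - \<alpha>) *
      integral {0..1} (\<lambda>w. x (b * exp (- (ln (b / t) * (1 - w powr \<beta>))))))"
proof -
  define L where "L = ln (b / t)"
  have "0 < L" "1 < \<beta>" using assms by (auto simp: L_def)
  have "(LINT \<tau>:{t..b}|lebesgue. ln (\<tau> / t) powr (- \<alpha>) * (x \<tau> / \<tau>)) = integral {0..1}
      (\<lambda>w. \<beta> * L powr (1 - \<alpha>) * x (b * exp (- (L * (1 - w powr \<beta>)))))"
  proof (rule set_lebesgue_integral_log_power_subst[where \<beta> = \<beta>])
    fix w :: real assume w: "0 < w" "w < 1"
    let ?\<tau> = "b * exp (- (L * (1 - w powr \<beta>)))"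
    have "?\<tau> / t = exp (L * w powr \<beta>)"
    proof -
      have "b / t = exp L" using assms by (simp add: L_def)
      then have "?\<tau> / t = exp L * exp (- (L * (1 - w powr \<beta>)))"
        by (metis times_divide_eq_left)
      then show ?thesis by (simp add: exp_add[symmetric] algebra_simps)
    qed
    then have "ln (?\<tau> / t) powr (- \<alpha>) = L powr (- \<alpha>) * w powr (- (\<beta> * \<alpha>))"
      using \<open>0 < L\<close> w by (simp add: powr_mult powr_powr)
    moreover have "L powr (1 - \<alpha>) = L * L powr (- \<alpha>)"
      using \<open>0 < L\<close> by (simp add: powr_diff powr_minus divide_simps)
    moreover have "w powr (\<beta> - 1) * w powr (- (\<beta> * \<alpha>)) = 1"
    proof -
      have "(\<beta> - 1) + (- (\<beta> * \<alpha>)) = 0" using assms by (simp add: field_simps)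
      then show ?thesis using w by (simp add: powr_add[symmetric])
    qed
    moreover have "?\<tau> * (x ?\<tau> / ?\<tau>) = x ?\<tau>" using assms by simp
    ultimately have "\<beta> * L powr (1 - \<alpha>) * x ?\<tau> =
        \<beta> * (L * L powr (- \<alpha>)) * (w powr (\<beta> - 1) * w powr (- (\<beta> * \<alpha>))) * (?\<tau> * (x ?\<tau> / ?\<tau>))"
      by (simp only: mult_1_right)
    also have "\<dots> = L * \<beta> * w powr (\<beta> - 1) * ?\<tau> *
        ((L powr (- \<alpha>) * w powr (- (\<beta> * \<alpha>))) * (x ?\<tau> / ?\<tau>))"
      by (simp only: mult_ac)
    finally show "\<beta> * L powr (1 - \<alpha>) * x ?\<tau> =
        ln (b / t) * \<beta> * w powr (\<beta> - 1) * (b * exp (- (ln (b / t) * (1 - w powr \<beta>)))) *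
        (ln (b * exp (- (ln (b / t) * (1 - w powr \<beta>))) / t) powr (- \<alpha>) *
          (x (b * exp (- (ln (b / t) * (1 - w powr \<beta>)))) /
            (b * exp (- (ln (b / t) * (1 - w powr \<beta>))))))"
      using \<open>ln (?\<tau> / t) powr (- \<alpha>) = L powr (- \<alpha>) * w powr (- (\<beta> * \<alpha>))\<close>
      unfolding L_def by (simp only:)
  qed (use assms \<open>1 < \<beta>\<close> in \<open>auto simp: L_def intro!: continuous_intros\<close>)
  then show ?thesis
    unfolding right_hadamard_integral_def L_def by simp
qed

lemma W_param:
  assumes "1 < \<beta>" "0 < t" "t < b"
    and cont: "continuous_on {0..1} (\<lambda>w. x (b * exp (- (ln (b / t) * (1 - w powr \<beta>)))))"
  shows "W b x n (n + 1 + k) t = integral {0..1} (\<lambda>w. ln (b / t) * \<beta> * w powr (\<beta> - 1) *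
      (real (Suc k) * (ln (b / t) * (1 - w powr \<beta>)) ^ k *
        x (b * exp (- (ln (b / t) * (1 - w powr \<beta>))))))"
proof -
  \<comment> \<open>The index shift p = n + 1 + k makes both truncated subtractions in
    \<open>W\<close> exact.\<close>
  have p: "n + 1 + k - n = Suc k" "Suc k - 1 = k" by simp_all
  show ?thesis
    unfolding W_def p
  proof (rule set_lebesgue_integral_log_power_subst[where \<beta> = \<beta>])
    show "continuous_on {0..1} (\<lambda>w. ln (b / t) * \<beta> * w powr (\<beta> - 1) *
      (real (Suc k) * (ln (b / t) * (1 - w powr \<beta>)) ^ k *
        x (b * exp (- (ln (b / t) * (1 - w powr \<beta>))))))"
      using assms by (intro continuous_intros continuous_on_powr') auto
  next
    fix w :: real
    let ?u = "ln (b / t) * (1 - w powr \<beta>)"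
    have "ln (b / (b * exp (- u))) = u" for u :: real
      using assms by (simp add: ln_div ln_mult)
    from this[of ?u]
    show "ln (b / t) * \<beta> * w powr (\<beta> - 1) * (real (Suc k) * ?u ^ k * x (b * exp (- ?u))) =
        ln (b / t) * \<beta> * w powr (\<beta> - 1) * (b * exp (- ?u)) *
        (real (Suc k) * ln (b / (b * exp (- ?u))) ^ k *
          (x (b * exp (- ?u)) / (b * exp (- ?u))))"
      using assms by simp
  qed (use assms in auto)
qed

text \<open>The reflection \<open>Gamma (- \<alpha>) * Gamma (1 + \<alpha>) = - (Gamma (1 -
  \<alpha>) * Gamma \<alpha>)\<close> makes the coefficients of the two summands opposite. The
  boundary part \<open>x t\<close> of \<open>W\<close> therefore cancels and only the remainder
  \<open>J\<close> survives.\<close>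

lemma expansion_term_eq:
  assumes "0 < \<alpha>" "\<alpha> < 1" "0 < ln (b / t)"
    and W: "W b x n (n + 1 + k) t = ln (b / t) ^ Suc k * (x t - J)"
  shows "expansion_term \<alpha> b x n t (n + 1 + k) =
    ln (b / t) powr (- \<alpha>) / Gamma (1 - \<alpha>) * (pochhammer \<alpha> (Suc k) / fact (Suc k) * J)"
proof -
  define L where "L = ln (b / t)"
  define c where "c = pochhammer \<alpha> (Suc k) / fact (Suc k)"
  have pos: "0 < Gamma \<alpha>" "0 < Gamma (1 - \<alpha>)"
    using assms by (auto intro: Gamma_real_pos)
  have "\<alpha> \<notin> \<int>"
    using assms by (auto elim!: Ints_cases)
  then have "\<alpha> \<notin> \<int>\<^sub>\<le>\<^sub>0" "- \<alpha> \<notin> \<int>\<^sub>\<le>\<^sub>0"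
    using nonpos_Ints_subset_Ints minus_in_Ints_iff by blast+
  have "Gamma (real (n + 1 + k) + \<alpha> - real n) = pochhammer \<alpha> (Suc k) * Gamma \<alpha>"
    using pochhammer_Gamma[OF \<open>\<alpha> \<notin> \<int>\<^sub>\<le>\<^sub>0\<close>, of "Suc k"] pos by (simp add: algebra_simps)
  then have num: "Gamma (real (n + 1 + k) + \<alpha> - real n) / fact (n + 1 + k - n) = c * Gamma \<alpha>"
    by (simp add: c_def)
  have "Gamma (1 + \<alpha>) = \<alpha> * Gamma \<alpha>"
    using Gamma_plus1[OF \<open>\<alpha> \<notin> \<int>\<^sub>\<le>\<^sub>0\<close>] by (simp add: add.commute)
  moreover have "Gamma (1 - \<alpha>) = - \<alpha> * Gamma (- \<alpha>)"
    using Gamma_plus1[OF \<open>- \<alpha> \<notin> \<int>\<^sub>\<le>\<^sub>0\<close>] by simp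
  ultimately have den: "Gamma (- \<alpha>) * Gamma (1 + \<alpha>) = - (Gamma (1 - \<alpha>) * Gamma \<alpha>)"
    by simp
  have B: "B_coeff \<alpha> n (n + 1 + k) = - (c / Gamma (1 - \<alpha>))"
  proof -
    have "B_coeff \<alpha> n (n + 1 + k) = (Gamma (real (n + 1 + k) + \<alpha> - real n) / fact (n + 1 + k - n)) /
        (Gamma (- \<alpha>) * Gamma (1 + \<alpha>))"
      by (simp only: B_coeff_def divide_divide_eq_left mult_ac)
    then show ?thesis unfolding num den using pos by simp
  qed
  have C: "Gamma (real (n + 1 + k) + \<alpha> - real n) /
      (Gamma (1 - \<alpha>) * Gamma \<alpha> * fact (n + 1 + k - n)) = c / Gamma (1 - \<alpha>)"
  proof -
    have "Gamma (real (n + 1 + k) + \<alpha> - real n) /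
        (Gamma (1 - \<alpha>) * Gamma \<alpha> * fact (n + 1 + k - n)) =
      (Gamma (real (n + 1 + k) + \<alpha> - real n) / fact (n + 1 + k - n)) / (Gamma (1 - \<alpha>) * Gamma \<alpha>)"
      by (simp only: divide_divide_eq_left mult_ac)
    then show ?thesis unfolding num using pos by simp
  qed
  have "real n - \<alpha> - real (n + 1 + k) = - \<alpha> - real (Suc k)" by simp
  then have powr: "L powr (real n - \<alpha> - real (n + 1 + k)) * L ^ Suc k = L powr (- \<alpha>)"
    using assms powr_realpow[of L "Suc k"] by (simp only: powr_diff L_def) simp
  have "expansion_term \<alpha> b x n t (n + 1 + k) =
      - (c / Gamma (1 - \<alpha>)) * (L powr (real n - \<alpha> - real (n + 1 + k)) * L ^ Suc k) * (x t - J) +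
      c / Gamma (1 - \<alpha>) * L powr (- \<alpha>) * x t"
    unfolding expansion_term_def B C W L_def by (simp only: mult.assoc)
  also have "\<dots> = L powr (- \<alpha>) / Gamma (1 - \<alpha>) * (c * J)"
    unfolding powr by (simp add: divide_inverse algebra_simps)
  finally show ?thesis by (simp only: L_def c_def)
qed

section \<open>Assembly of the expansion\<close>

theorem mainTheorem5:
  fixes \<alpha> a b :: real and n :: nat and x :: "real \<Rightarrow> real"
  assumes "0 < \<alpha>" and "\<alpha> < 1"
    and "n \<ge> 1"
    and "0 < a" and "a < b"
    and "C_k_on (n + 1) x {a..b}"
  shows "(\<forall>i\<in>{1..n}. summable (\<lambda>k. A_term \<alpha> n i (n - i + 1 + k))) \<and>
    (\<forall>t\<in>{a<..<b}.
      right_hadamard_integral \<alpha> b x differentiable (at t) \<and>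
      summable (\<lambda>k. expansion_term \<alpha> b x n t (n + 1 + k)) \<and>
      right_hadamard_deriv \<alpha> b x t =
        1 / Gamma (1 - \<alpha>) * ln (b / t) powr (- \<alpha>) * x t
        + (\<Sum>i=1..n. A_coeff \<alpha> n i * ln (b / t) powr (real i - \<alpha>) * x_iter x i t)
        + (\<Sum>k. expansion_term \<alpha> b x n t (n + 1 + k)))"
proof (intro conjI ballI)
  fix i assume "i \<in> {1..n}"
  then show "summable (\<lambda>k. A_term \<alpha> n i (n - i + 1 + k))"
    using A_term_sums[OF assms(1,2)] by (auto intro: sums_summable)
next
  fix t assume t: "t \<in> {a<..<b}"
  define \<beta> where "\<beta> = 1 / (1 - \<alpha>)"
  define M where "M = ln (b / a)"
  define L where "L = ln (b / t)"
  have "1 < \<beta>" using assms by (simp add: \<beta>_def)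
  obtain x' where x': "\<forall>\<tau>\<in>{a..b}. (x has_real_derivative x' \<tau>) (at \<tau> within {a..b})"
    and "C_k_on n x' {a..b}"
    using assms(6) by auto
  then have x'_cont: "continuous_on {a..b} x'"
    by (auto intro: C_k_on_imp_continuous_on)
  define z where "z = (\<lambda>s. x (b * exp (- s)))"
  define z' where "z' = (\<lambda>s. - (b * exp (- s) * x' (b * exp (- s))))"
  have range: "b * exp (- s) \<in> {a..b}" if "s \<in> {0..M}" for s
    using exp_param_in_interval[OF assms(4,5)] that by (simp add: M_def)
  have z_deriv: "\<forall>s\<in>{0..M}. (z has_real_derivative z' s) (at s within {0..M})"
  proof
    fix s assume s: "s \<in> {0..M}"
    have "(x has_real_derivative x' (b * exp (- s)))
        (at (b * exp (- s)) within (\<lambda>s. b * exp (- s)) ` {0..M})"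
      using range s by (intro has_field_derivative_subset[OF bspec[OF x']]) auto
    moreover have "((\<lambda>s. b * exp (- s)) has_real_derivative - (b * exp (- s))) (at s within {0..M})"
      by (auto intro!: derivative_eq_intros)
    ultimately have "(x \<circ> (\<lambda>s. b * exp (- s)) has_real_derivative
        x' (b * exp (- s)) * - (b * exp (- s))) (at s within {0..M})"
      by (rule DERIV_image_chain)
    then show "(z has_real_derivative z' s) (at s within {0..M})"
      by (simp add: z_def z'_def o_def mult_ac)
  qed
  have z'_cont: "continuous_on {0..M} z'"
    unfolding z'_def using range
    by (intro continuous_intros continuous_on_compose2[OF x'_cont]) auto
  have L_range: "0 < ln (b / \<tau>)" "ln (b / \<tau>) < M" if "\<tau> \<in> {a<..<b}" for \<tau>
    using that assms by (auto simp: M_def divide_strict_left_mono)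
  then have L: "0 < L" "L < M" using t by (auto simp: L_def)
  \<comment> \<open>Stated for every point of the open interval, because differentiating at
    \<open>t\<close> needs the w-form of the integral in a neighbourhood.\<close>
  have z_param_cont: "continuous_on {0..1}
      (\<lambda>w. x (b * exp (- (ln (b / \<tau>) * (1 - w powr \<beta>)))))" if "\<tau> \<in> {a<..<b}" for \<tau>
    using continuous_on_param[OF \<open>1 < \<beta>\<close> z_deriv z'_cont L_range[OF that]
        z_cont[OF \<open>1 < \<beta>\<close> z_deriv z'_cont]]
    by (simp add: z_def)

  define J where "J = integral {0..1} (\<lambda>w. z' (L * (1 - w powr \<beta>)))"
  define D where "D = L powr (- \<alpha>) * (z 0 + L * \<beta> * J)"
  have "((\<lambda>L. \<beta> * L powr (1 - \<alpha>) * integral {0..1} (\<lambda>w. z (L * (1 - w powr \<beta>))))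
      has_real_derivative D) (at L)"
    unfolding D_def J_def
    by (rule has_derivative_fractional_integral_param[OF \<open>1 < \<beta>\<close> z_deriv z'_cont L assms(2) \<beta>_def])
  \<comment> \<open>This inner derivative later cancels the factor \<open>- t\<close> of the
    Hadamard derivative.\<close>
  moreover have "((\<lambda>\<tau>. ln (b / \<tau>)) has_real_derivative - (1 / t)) (at t)"
    using t assms by (auto intro!: derivative_eq_intros simp: field_simps power2_eq_square)
  ultimately have "((\<lambda>\<tau>. 1 / Gamma (1 - \<alpha>) * (\<beta> * ln (b / \<tau>) powr (1 - \<alpha>) *
      integral {0..1} (\<lambda>w. z (ln (b / \<tau>) * (1 - w powr \<beta>)))))
      has_real_derivative 1 / Gamma (1 - \<alpha>) * (D * - (1 / t))) (at t)"
    unfolding L_def by (intro DERIV_cmult DERIV_chain2)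
  then have deriv: "(right_hadamard_integral \<alpha> b x
      has_real_derivative 1 / Gamma (1 - \<alpha>) * (D * - (1 / t))) (at t)"
  proof (rule has_field_derivative_transform_within_open)
    fix \<tau> assume "\<tau> \<in> {a<..<b}"
    then show "1 / Gamma (1 - \<alpha>) * (\<beta> * ln (b / \<tau>) powr (1 - \<alpha>) *
        integral {0..1} (\<lambda>w. z (ln (b / \<tau>) * (1 - w powr \<beta>)))) =
        right_hadamard_integral \<alpha> b x \<tau>"
      using right_hadamard_integral_param[OF assms(1,2) \<beta>_def _ _ z_param_cont] assms
      by (simp add: z_def)
  qed (use t in auto)
  then show "right_hadamard_integral \<alpha> b x differentiable (at t)"
    by (auto simp: real_differentiable_def)

  define c where "c = (\<lambda>m. pochhammer \<alpha> m / fact m * integral {0..1}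
      (\<lambda>w. (1 - w powr \<beta>) ^ m * w powr (\<beta> - 1) * z' (L * (1 - w powr \<beta>))))"
  have "x t = z L"
    using t assms by (simp add: z_def L_def exp_minus)
  have "expansion_term \<alpha> b x n t (n + 1 + k) =
      L powr (- \<alpha>) / Gamma (1 - \<alpha>) * (L * \<beta> * c (Suc k))" for k
  proof -
    have "W b x n (n + 1 + k) t = L ^ Suc k * (x t - L * \<beta> * integral {0..1}
      (\<lambda>w. (1 - w powr \<beta>) ^ Suc k * w powr (\<beta> - 1) * z' (L * (1 - w powr \<beta>))))"
      using W_param[OF \<open>1 < \<beta>\<close> _ _ z_param_cont[OF t], of n k] t assms
        integral_param_moment[OF \<open>1 < \<beta>\<close> z_deriv z'_cont L, of k]
      unfolding \<open>x t = z L\<close> by (simp add: z_def L_def del: power_Suc of_nat_Suc)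
    from expansion_term_eq[OF assms(1,2) _ this[unfolded L_def]] L
    show ?thesis by (simp add: L_def c_def mult_ac del: power_Suc pochhammer_Suc fact_Suc)
  qed
  \<comment> \<open>The expansion starts at p = n + 1, that is at m = 1, so the moment of order 0 is
    split off.\<close>
  moreover have "(\<lambda>k. c (Suc k)) sums (J - c 0)"
    using binomial_moment_series[OF \<open>1 < \<beta>\<close> z_deriv z'_cont L assms(1,2) \<beta>_def]
    unfolding c_def J_def by (subst sums_Suc_iff) simp
  ultimately have series: "(\<lambda>k. expansion_term \<alpha> b x n t (n + 1 + k)) sums
      (L powr (- \<alpha>) / Gamma (1 - \<alpha>) * (L * \<beta> * (J - c 0)))"
    by (simp only:) (intro sums_mult)
  then show "summable (\<lambda>k. expansion_term \<alpha> b x n t (n + 1 + k))"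
    by (rule sums_summable)

  \<comment> \<open>The split-off moment accounts for the leading term in \<open>x t\<close>, as
    \<open>z L\<close> is \<open>x t\<close>; \<open>z 0\<close> is the boundary value
    \<open>x b\<close>.\<close>
  have "L * \<beta> * c 0 = z L - z 0"
    using integral_param_deriv[OF \<open>1 < \<beta>\<close> z_deriv z'_cont L] by (simp add: c_def)
  then have "L * \<beta> * (J - c 0) = z 0 + L * \<beta> * J - z L"
    by (simp add: right_diff_distrib)
  then have sum: "(\<Sum>k. expansion_term \<alpha> b x n t (n + 1 + k)) =
      L powr (- \<alpha>) / Gamma (1 - \<alpha>) * (z 0 + L * \<beta> * J - z L)"
    using sums_unique[OF series] by simp
  have A: "A_coeff \<alpha> n i = 0" if "i \<in> {1..n}" for i
    using sums_unique[OF A_term_sums[OF assms(1,2)], of i n] that by (simp add: A_coeff_def)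
  have "right_hadamard_deriv \<alpha> b x t = 1 / Gamma (1 - \<alpha>) * D"
    using DERIV_imp_deriv[OF deriv] t assms by (simp add: right_hadamard_deriv_def)
  then show "right_hadamard_deriv \<alpha> b x t =
        1 / Gamma (1 - \<alpha>) * ln (b / t) powr (- \<alpha>) * x t
        + (\<Sum>i=1..n. A_coeff \<alpha> n i * ln (b / t) powr (real i - \<alpha>) * x_iter x i t)
        + (\<Sum>k. expansion_term \<alpha> b x n t (n + 1 + k))"
    unfolding sum by (simp add: A \<open>x t = z L\<close> D_def L_def[symmetric] algebra_simps
        add_divide_distrib diff_divide_distrib)
qed

end
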